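(* Let $G$ be a compact topological group acting continuously and faithfully on a compact metric space $(X, m)$, and assume that every element of $G$ acts as an isometry, i.e. $m(gx, gy) = m(x,y)$ for all $g \in G$ and $x, y \in X$. Let $a$ and $b$ belong to $G$. For positive integers $M$ and $N$ define $$\delta_{M,N}(a,b) = \min\big\{\varphi(a^p b^n) : p, n \in \mathbb{Z},\ |p| \le M,\ |n| \le N,\ \text{and } (p,n) \ne (0,0)\big\}.$$ Then $$\Phi\big(\tfrac12 \delta_{M,N}(a,b)\big) \le (M+1)^{-1}(N+1)^{-1}.$$ If, moreover, the metric $m$ is nonarchimedean, then $$\Phi\big(\delta_{M,N}(a,b)\big) \le (M+1)^{-1}(N+1)^{-1}.$$
   Context: The action $G \times X \to X$, $(g,x) \mapsto gx$, is continuous (jointly) and faithful. The function $\varphi : G \to [0,\infty)$ is $\varphi(g) = \sup\{m(gx, x) : x \in X\}$. $\mu$ denotes the Haar measure on the Borel subsets of $G$ normalized so that $\mu(G) = 1$ (it is both left and right invariant), and for $t \ge 0$, $\Phi(t) = \mu\{g \in G : \varphi(g) < t\}$. The metric $m$ is nonarchimedean if $m(x,y) \le \max\{m(x,z), m(z,y)\}$ for all $x, y, z \in X$. *)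

theory Defs
  imports "HOL-Analysis.Analysis" "HOL-Algebra.Group_Action"
begin

definition topological_group :: "('g, 'b) monoid_scheme \<Rightarrow> 'g topology \<Rightarrow> bool" where
  "topological_group G T \<longleftrightarrow>
     group G \<and> topspace T = carrier G \<and>
     continuous_map (prod_topology T T) T (\<lambda>(g, h). g \<otimes>\<^bsub>G\<^esub> h) \<and>
     continuous_map T T (\<lambda>g. inv\<^bsub>G\<^esub> g)"

text \<open>No Hausdorff condition is imposed. In the presence of a faithful continuous action on a
  metric space the group topology is automatically Hausdorff, so this agrees with either
  convention for compact topological groups.\<close>

definition compact_topological_group :: "('g, 'b) monoid_scheme \<Rightarrow> 'g topology \<Rightarrow> bool" where
  "compact_topological_group G T \<longleftrightarrow> topological_group G T \<and> compact_space T"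

definition compact_metric_space :: "'x set \<Rightarrow> ('x \<Rightarrow> 'x \<Rightarrow> real) \<Rightarrow> bool" where
  "compact_metric_space X m \<longleftrightarrow>
     Metric_space X m \<and> compact_space (Metric_space.mtopology X m)"

definition nonarchimedean :: "'x set \<Rightarrow> ('x \<Rightarrow> 'x \<Rightarrow> real) \<Rightarrow> bool" where
  "nonarchimedean X m \<longleftrightarrow> (\<forall>x\<in>X. \<forall>y\<in>X. \<forall>z\<in>X. m x y \<le> max (m x z) (m z y))"

text \<open>The normalized Haar measure of a compact group: the regular Borel probability measure
  that is left (and hence, by compactness, right) invariant.\<close>

definition normalized_haar_measure ::
    "('g, 'b) monoid_scheme \<Rightarrow> 'g topology \<Rightarrow> 'g measure \<Rightarrow> bool" where
  "normalized_haar_measure G T \<mu> \<longleftrightarrow>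
     sets \<mu> = sigma_sets (carrier G) {U. openin T U} \<and>
     emeasure \<mu> (carrier G) = 1 \<and>
     (\<forall>g\<in>carrier G. \<forall>A\<in>sets \<mu>.
        emeasure \<mu> (g <#\<^bsub>G\<^esub> A) = emeasure \<mu> A \<and>
        emeasure \<mu> (A #>\<^bsub>G\<^esub> g) = emeasure \<mu> A) \<and>
     (\<forall>A\<in>sets \<mu>. emeasure \<mu> A = (INF U\<in>{U. openin T U \<and> A \<subseteq> U}. emeasure \<mu> U)) \<and>
     (\<forall>U. openin T U \<longrightarrow>
        emeasure \<mu> U = (SUP K\<in>{K. compactin T K \<and> K \<in> sets \<mu> \<and> K \<subseteq> U}. emeasure \<mu> K))"

text \<open>The supremum is taken in \<open>[0, \<infinity>)\<close>, so it is \<open>0\<close> for empty \<open>X\<close>; the supremum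
  of the empty set in type \<^typ>\<open>real\<close> is unspecified, hence the case distinction.\<close>

definition displacement ::
    "'x set \<Rightarrow> ('x \<Rightarrow> 'x \<Rightarrow> real) \<Rightarrow> ('g \<Rightarrow> 'x \<Rightarrow> 'x) \<Rightarrow> 'g \<Rightarrow> real" where
  "displacement X m act g = (if X = {} then 0 else (SUP x\<in>X. m (act g x) x))"

definition displacement_measure ::
    "('g, 'b) monoid_scheme \<Rightarrow> 'g measure \<Rightarrow> 'x set \<Rightarrow> ('x \<Rightarrow> 'x \<Rightarrow> real) \<Rightarrow>
      ('g \<Rightarrow> 'x \<Rightarrow> 'x) \<Rightarrow> real \<Rightarrow> real" where
  "displacement_measure G \<mu> X m act t =
     measure \<mu> {g \<in> carrier G. displacement X m act g < t}"

definition min_displacement ::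
    "('g, 'b) monoid_scheme \<Rightarrow> 'x set \<Rightarrow> ('x \<Rightarrow> 'x \<Rightarrow> real) \<Rightarrow> ('g \<Rightarrow> 'x \<Rightarrow> 'x) \<Rightarrow>
      nat \<Rightarrow> nat \<Rightarrow> 'g \<Rightarrow> 'g \<Rightarrow> real" where
  "min_displacement G X m act M N a b =
     Min {displacement X m act (a [^]\<^bsub>G\<^esub> p \<otimes>\<^bsub>G\<^esub> b [^]\<^bsub>G\<^esub> n) | p n :: int.
            \<bar>p\<bar> \<le> int M \<and> \<bar>n\<bar> \<le> int N \<and> (p, n) \<noteq> (0, 0)}"

end

theory Submission
  imports Defs
begin

text \<open>
  Let \<open>\<delta>\<close> be the minimal displacement of the nontrivial words \<open>a\<^sup>p b\<^sup>n\<close>, and let \<open>B\<close> be a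
  displacement ball \<open>{g. \<phi> g < t}\<close>.  The idea is a packing argument: the \<open>(M + 1)(N + 1)\<close> left
  translates of \<open>B\<close> by the elements \<open>a\<^sup>i b\<^sup>j\<close> with \<open>0 \<le> i \<le> M\<close>, \<open>0 \<le> j \<le> N\<close> are pairwise disjoint
  when \<open>t\<close> is small, they all have the measure of \<open>B\<close>, and together they fit into a group of measure
  \<open>1\<close>.

  Disjointness is the point where \<open>\<delta>\<close> enters.  If \<open>a\<^sup>i b\<^sup>j g = a\<^sup>k b\<^sup>l h\<close> with \<open>g\<close> and \<open>h\<close> in \<open>B\<close>, then
  \<open>h g\<^sup>-\<^sup>1 = b\<^sup>-\<^sup>l a\<^sup>i\<^sup>-\<^sup>k b\<^sup>j\<close>.  The group need not be commutative, but the right-hand side is the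
  conjugate by \<open>b\<^sup>l\<close> of the word \<open>a\<^sup>i\<^sup>-\<^sup>k b\<^sup>j\<^sup>-\<^sup>l\<close>, and displacement is a class function because the
  action is by isometries (\<open>displacement_conjugate\<close>); so its displacement is at least \<open>\<delta>\<close>.
  The left-hand side has displacement at most \<open>\<phi> h + \<phi> g < 2t\<close> (\<open>displacement_quotient_le\<close>), or at
  most \<open>max (\<phi> h) (\<phi> g) < t\<close> for a nonarchimedean metric (\<open>displacement_quotient_le_max\<close>).  Hence
  \<open>t = \<delta> / 2\<close> works in general and \<open>t = \<delta>\<close> in the nonarchimedean case.
\<close>

section \<open>Packing by translates\<close>

text \<open>Disjoint translates of \<open>B\<close> have equal measures adding up to at most \<open>1\<close>.  A nonmeasurable
  \<open>B\<close> has measure \<open>0\<close> by convention and falls under the trivial case.\<close>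

lemma (in group) card_disjoint_translates_le:
  assumes inv: "\<And>g. g \<in> carrier G \<Longrightarrow> emeasure \<mu> (g <#\<^bsub>G\<^esub> B) = emeasure \<mu> B"
    and total: "emeasure \<mu> (carrier G) = 1"
    and B: "B \<subseteq> carrier G"
    and I: "finite I" "\<And>i. i \<in> I \<Longrightarrow> h i \<in> carrier G"
    and disj: "disjoint_family_on (\<lambda>i. h i <#\<^bsub>G\<^esub> B) I"
  shows "real (card I) * measure \<mu> B \<le> 1"
proof (cases "emeasure \<mu> B = 0")
  case True
  then show ?thesis by (simp add: measure_def)
next
  case False
  \<comment> \<open>A set of nonzero measure is measurable, so invariance already makes the translates of \<open>B\<close>
     measurable.\<close>
  have meas: "(\<lambda>i. h i <#\<^bsub>G\<^esub> B) ` I \<subseteq> sets \<mu>"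
    using inv I False by (auto intro!: emeasure_neq_0_sets)
  have carr: "carrier G \<in> sets \<mu>"
    using total by (intro emeasure_neq_0_sets) simp
  have le_one: "emeasure \<mu> B \<le> 1"
    using emeasure_mono[OF B carr] total by simp
  then have B_measure: "emeasure \<mu> B = ennreal (measure \<mu> B)"
    by (intro emeasure_eq_ennreal_measure) (auto simp: top_unique)
  have "ennreal (real (card I) * measure \<mu> B) = (\<Sum>i\<in>I. emeasure \<mu> (h i <#\<^bsub>G\<^esub> B))"
    using inv I by (simp add: B_measure ennreal_mult ennreal_of_nat_eq_real_of_nat)
  also have "\<dots> = emeasure \<mu> (\<Union>i\<in>I. h i <#\<^bsub>G\<^esub> B)"
    by (rule sum_emeasure[OF meas disj I(1)])
  also have "\<dots> \<le> emeasure \<mu> (carrier G)"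
    using I B by (intro emeasure_mono carr) (auto simp: l_coset_def)
  finally show ?thesis
    by (simp add: total)
qed

section \<open>Displacement under an isometric action\<close>

text \<open>Boundedness of the space makes the supremum defining the displacement a genuine one.\<close>

locale bounded_isometric_action =
  group_action G X act + Metric_space X m
  for G :: "('g, 'b) monoid_scheme" (structure) and X :: "'x set"
    and act :: "'g \<Rightarrow> 'x \<Rightarrow> 'x" and m :: "'x \<Rightarrow> 'x \<Rightarrow> real" +
  assumes isometry: "\<lbrakk>g \<in> carrier G; x \<in> X; y \<in> X\<rbrakk> \<Longrightarrow> m (act g x) (act g y) = m x y"
    and bounded: "mbounded X"
begin

abbreviation disp :: "'g \<Rightarrow> real" where
  "disp \<equiv> displacement X m act"

sublocale group G
  by (rule group_hom.axioms(1)[OF group_hom])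

lemma dist_le_displacement:
  assumes "g \<in> carrier G" "x \<in> X"
  shows "m (act g x) x \<le> disp g"
proof -
  obtain c where c: "\<And>x y. \<lbrakk>x \<in> X; y \<in> X\<rbrakk> \<Longrightarrow> m x y \<le> c"
    using bounded by (auto simp: mbounded_alt)
  have "bdd_above ((\<lambda>x. m (act g x) x) ` X)"
    using assms(1) c element_image by (intro bdd_aboveI2[of _ _ c]) blast
  then show ?thesis
    using assms(2) by (auto simp: displacement_def intro: cSUP_upper)
qed

text \<open>Moving \<open>x\<close> by \<open>k\<^sup>-\<^sup>1 g k\<close> covers the same distance as moving \<open>k x\<close> by \<open>g\<close>, and \<open>k x\<close>
  runs through all of \<open>X\<close> when \<open>x\<close> does.\<close>

lemma displacement_conjugate:
  assumes g: "g \<in> carrier G" and k: "k \<in> carrier G"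
  shows "disp (inv k \<otimes> g \<otimes> k) = disp g"
proof -
  have eq: "m (act (inv k \<otimes> g \<otimes> k) x) x = m (act g (act k x)) (act k x)" if x: "x \<in> X" for x
  proof -
    have kx: "act k x \<in> X" and gkx: "act g (act k x) \<in> X"
      using element_image g k x by blast+
    have "act (inv k \<otimes> g \<otimes> k) x = act (inv k) (act g (act k x))"
      using g k x kx by (simp add: composition_rule m_assoc)
    moreover have "act (inv k) (act k x) = x"
      using k x orbit_sym_aux by simp
    ultimately show ?thesis
      using isometry[of "inv k" "act g (act k x)" "act k x"] k kx gkx by simp
  qed
  have "(\<lambda>x. m (act (inv k \<otimes> g \<otimes> k) x) x) ` X = (\<lambda>y. m (act g y) y) ` (act k ` X)"
    by (simp add: image_image eq)
  also have "act k ` X = X"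
    by (rule surj_prop[OF k])
  finally show ?thesis
    by (simp add: displacement_def)
qed

text \<open>With \<open>y = h\<^sup>-\<^sup>1 x\<close>, the distance from \<open>g h\<^sup>-\<^sup>1 x\<close> to \<open>x\<close> is the distance from \<open>g y\<close> to \<open>h y\<close>, which
  can be estimated by passing through \<open>y\<close>.  The condition \<open>0 \<le> c\<close> covers empty \<open>X\<close>.\<close>

lemma displacement_quotient_leI:
  assumes g: "g \<in> carrier G" and h: "h \<in> carrier G"
    and le: "\<And>y. y \<in> X \<Longrightarrow> m (act g y) (act h y) \<le> c" and c: "0 \<le> c"
  shows "disp (g \<otimes> inv h) \<le> c"
proof -
  have "m (act (g \<otimes> inv h) x) x \<le> c" if x: "x \<in> X" for x
  proof -
    have y: "act (inv h) x \<in> X"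
      using element_image h x inv_closed by blast
    have "act h (act (inv h) x) = x"
      using orbit_sym_aux[OF inv_closed[OF h] x refl] h by simp
    then show ?thesis
      using le[OF y] g h x by (simp add: composition_rule)
  qed
  then show ?thesis
    using c by (auto simp: displacement_def intro!: cSUP_least)
qed

lemma displacement_nonneg:
  assumes "g \<in> carrier G"
  shows "0 \<le> disp g"
proof (cases "X = {}")
  case False
  then obtain x where "x \<in> X" by blast
  then show ?thesis
    using dist_le_displacement[OF assms] nonneg order_trans by blast
qed (simp add: displacement_def)

lemma displacement_quotient_le:
  assumes "g \<in> carrier G" "h \<in> carrier G"
  shows "disp (g \<otimes> inv h) \<le> disp g + disp h"
proof (rule displacement_quotient_leI[OF assms])
  fix y assume y: "y \<in> X"
  have "act g y \<in> X" "act h y \<in> X"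
    using element_image assms y by blast+
  then have "m (act g y) (act h y) \<le> m (act g y) y + m (act h y) y"
    using triangle[of "act g y" y "act h y"] y by (simp add: commute[of y])
  then show "m (act g y) (act h y) \<le> disp g + disp h"
    using dist_le_displacement[OF assms(1) y] dist_le_displacement[OF assms(2) y] by simp
qed (intro add_nonneg_nonneg displacement_nonneg assms)

lemma displacement_quotient_le_max:
  assumes "nonarchimedean X m" "g \<in> carrier G" "h \<in> carrier G"
  shows "disp (g \<otimes> inv h) \<le> max (disp g) (disp h)"
proof (rule displacement_quotient_leI[OF assms(2,3)])
  fix y assume y: "y \<in> X"
  have "m (act g y) (act h y) \<le> max (m (act g y) y) (m (act h y) y)"
    using assms(1) element_image assms(2,3) y
    unfolding nonarchimedean_def by (metis commute)
  then show "m (act g y) (act h y) \<le> max (disp g) (disp h)"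
    using dist_le_displacement[OF assms(2) y] dist_le_displacement[OF assms(3) y] by simp
qed (use assms displacement_nonneg[OF assms(2)] in simp)

section \<open>Disjointness of the translates\<close>

lemma min_displacement_le:
  fixes p n :: int
  assumes "\<bar>p\<bar> \<le> int M" "\<bar>n\<bar> \<le> int N" "(p, n) \<noteq> (0, 0)"
  shows "min_displacement G X m act M N a b \<le> disp (a [^] p \<otimes> b [^] n)"
proof -
  let ?S = "{disp (a [^] p \<otimes> b [^] n) | p n :: int.
               \<bar>p\<bar> \<le> int M \<and> \<bar>n\<bar> \<le> int N \<and> (p, n) \<noteq> (0, 0)}"
  have "?S \<subseteq> (\<lambda>(p, n). disp (a [^] p \<otimes> b [^] n)) ` ({- int M..int M} \<times> {- int N..int N})"
    by (auto simp: abs_le_iff)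
  then have "finite ?S"
    by (rule finite_subset) simp
  then show ?thesis
    unfolding min_displacement_def using assms by (intro Min_le) blast+
qed

text \<open>The element \<open>b\<^sup>-\<^sup>l a\<^sup>i\<^sup>-\<^sup>k b\<^sup>j\<close> is the conjugate by \<open>b\<^sup>l\<close> of \<open>a\<^sup>i\<^sup>-\<^sup>k b\<^sup>j\<^sup>-\<^sup>l\<close>, one of the words
  over which the minimum is taken.  Exponents range over initial segments of the naturals so that
  their differences fill exactly the windows \<open>\<bar>p\<bar> \<le> M\<close> and \<open>\<bar>n\<bar> \<le> N\<close>.\<close>

lemma min_displacement_le_quotient:
  fixes i j k l :: nat
  assumes a: "a \<in> carrier G" and b: "b \<in> carrier G"
    and bounds: "i \<le> M" "k \<le> M" "j \<le> N" "l \<le> N" and ne: "(i, j) \<noteq> (k, l)"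
  shows "min_displacement G X m act M N a b
           \<le> disp (inv (a [^] int k \<otimes> b [^] int l) \<otimes> (a [^] int i \<otimes> b [^] int j))"
proof -
  let ?w = "a [^] (int i - int k) \<otimes> b [^] (int j - int l)"
  have a_eq: "inv (a [^] int k) \<otimes> a [^] int i = a [^] (int i - int k)"
    using a by (simp flip: int_pow_neg int_pow_mult)
  have b_eq: "b [^] int j = b [^] (int j - int l) \<otimes> b [^] int l"
    using b by (simp flip: int_pow_mult)
  have "inv (a [^] int k \<otimes> b [^] int l) \<otimes> (a [^] int i \<otimes> b [^] int j)
      = inv (b [^] int l) \<otimes> (inv (a [^] int k) \<otimes> a [^] int i) \<otimes> b [^] int j"
    using a b by (simp add: inv_mult_group m_assoc del: int_pow_int)
  also have "\<dots> = inv (b [^] int l) \<otimes> a [^] (int i - int k)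
                  \<otimes> (b [^] (int j - int l) \<otimes> b [^] int l)"
    by (simp only: a_eq b_eq)
  also have "\<dots> = inv (b [^] int l) \<otimes> ?w \<otimes> b [^] int l"
    using a b by (simp add: m_assoc del: int_pow_int)
  finally have "inv (a [^] int k \<otimes> b [^] int l) \<otimes> (a [^] int i \<otimes> b [^] int j)
      = inv (b [^] int l) \<otimes> ?w \<otimes> b [^] int l" .
  then have "disp (inv (a [^] int k \<otimes> b [^] int l) \<otimes> (a [^] int i \<otimes> b [^] int j)) = disp ?w"
    using a b by (simp add: displacement_conjugate del: int_pow_int)
  moreover have "min_displacement G X m act M N a b \<le> disp ?w"
    using bounds ne by (intro min_displacement_le) auto
  ultimately show ?thesis by simp
qed

text \<open>The two estimates of the theorem differ only in how small the radius \<open>t\<close> must be for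
  quotients of elements of the ball to have displacement below the minimum.\<close>

lemma displacement_measure_le:
  assumes inv: "\<And>g B. \<lbrakk>g \<in> carrier G; B \<in> sets \<mu>\<rbrakk> \<Longrightarrow> emeasure \<mu> (g <#\<^bsub>G\<^esub> B) = emeasure \<mu> B"
    and total: "emeasure \<mu> (carrier G) = 1"
    and a: "a \<in> carrier G" and b: "b \<in> carrier G"
    and quot: "\<And>g h. \<lbrakk>g \<in> carrier G; h \<in> carrier G; disp g < t; disp h < t\<rbrakk>
                 \<Longrightarrow> disp (g \<otimes> inv h) < min_displacement G X m act M N a b"
  shows "displacement_measure G \<mu> X m act t \<le> inverse (real M + 1) * inverse (real N + 1)"
proof -
  define B where "B = {g \<in> carrier G. disp g < t}"
  define w where "w = (\<lambda>(i, j). a [^] int i \<otimes> b [^] int j)"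
  let ?I = "{..M} \<times> {..N}"
  have w_closed: "w s \<in> carrier G" for s
    using a b by (simp add: w_def split_beta)
  have disj: "disjoint_family_on (\<lambda>s. w s <#\<^bsub>G\<^esub> B) ?I"
    unfolding disjoint_family_on_def
  proof (intro ballI impI equals0I)
    fix s s' x assume s: "s \<in> ?I" and s': "s' \<in> ?I" and ne: "s \<noteq> s'"
      and "x \<in> (w s <#\<^bsub>G\<^esub> B) \<inter> (w s' <#\<^bsub>G\<^esub> B)"
    then obtain g h where g: "g \<in> B" and h: "h \<in> B" and eq: "w s \<otimes> g = w s' \<otimes> h"
      by (auto simp: l_coset_def)
    have gc: "g \<in> carrier G" and hc: "h \<in> carrier G"
      using g h by (auto simp: B_def)
    have "inv (w s') \<otimes> w s = inv (w s') \<otimes> (w s \<otimes> g) \<otimes> inv g"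
      using w_closed gc by (simp add: m_assoc)
    also have "\<dots> = h \<otimes> inv g"
      unfolding eq using w_closed hc by (simp flip: m_assoc)
    finally have "disp (inv (w s') \<otimes> w s) < min_displacement G X m act M N a b"
      using quot g h by (auto simp: B_def)
    moreover have "min_displacement G X m act M N a b \<le> disp (inv (w s') \<otimes> w s)"
      using min_displacement_le_quotient[OF a b, of "fst s" M "fst s'" "snd s" N "snd s'"] s s' ne
      by (auto simp: w_def split_beta)
    ultimately show False by simp
  qed
  have "(real M + 1) * (real N + 1) * measure \<mu> B \<le> 1"
  proof (cases "B \<in> sets \<mu>")
    case True
    have "real (card ?I) * measure \<mu> B \<le> 1"
      using inv True total w_closed disj
      by (intro card_disjoint_translates_le[where h = w]) (auto simp: B_def)
    then show ?thesis by (simp add: algebra_simps)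
  qed (simp add: measure_notin_sets)
  moreover have "(real M + 1) * (real N + 1) > 0" by simp
  ultimately have "measure \<mu> B \<le> inverse ((real M + 1) * (real N + 1))"
    by (simp only: inverse_eq_divide pos_le_divide_eq mult.commute)
  then show ?thesis
    by (simp only: displacement_measure_def B_def inverse_mult_distrib)
qed

end

theorem theorem4:
  fixes G :: "('g, 'b) monoid_scheme"
    and T :: "'g topology"
    and \<mu> :: "'g measure"
    and X :: "'x set"
    and m :: "'x \<Rightarrow> 'x \<Rightarrow> real"
    and act :: "'g \<Rightarrow> 'x \<Rightarrow> 'x"
    and a b :: 'g
    and M N :: nat
  assumes "compact_topological_group G T"
    and "compact_metric_space X m"
    and "faithful_action G X act"
    and "continuous_map (prod_topology T (Metric_space.mtopology X m)) (Metric_space.mtopology X m)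
           (\<lambda>(g, x). act g x)"
    and "\<And>g x y. \<lbrakk>g \<in> carrier G; x \<in> X; y \<in> X\<rbrakk> \<Longrightarrow> m (act g x) (act g y) = m x y"
    and "normalized_haar_measure G T \<mu>"
    and "a \<in> carrier G" and "b \<in> carrier G"
    and "M > 0" and "N > 0"
  shows "displacement_measure G \<mu> X m act (1/2 * min_displacement G X m act M N a b)
           \<le> inverse (real M + 1) * inverse (real N + 1)
       \<and> (nonarchimedean X m \<longrightarrow>
           displacement_measure G \<mu> X m act (min_displacement G X m act M N a b)
             \<le> inverse (real M + 1) * inverse (real N + 1))"
proof -
  interpret faithful_action G X act by fact
  interpret Metric_space X m
    using assms(2) by (simp add: compact_metric_space_def)
  have "mbounded X"
    using assms(2) compactin_imp_mbounded[of X]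
    by (simp add: compact_metric_space_def compact_space_def)
  then interpret bounded_isometric_action G X act m
    using assms(5) by unfold_locales auto
  have total: "emeasure \<mu> (carrier G) = 1"
    and inv: "\<And>g B. \<lbrakk>g \<in> carrier G; B \<in> sets \<mu>\<rbrakk>
                \<Longrightarrow> emeasure \<mu> (g <#\<^bsub>G\<^esub> B) = emeasure \<mu> B"
    using assms(6) by (auto simp: normalized_haar_measure_def)
  let ?\<delta> = "min_displacement G X m act M N a b"
  note packing = displacement_measure_le[where a = a and b = b, OF _ total assms(7,8)]
  have "disp (g \<otimes>\<^bsub>G\<^esub> inv\<^bsub>G\<^esub> h) < ?\<delta>"
    if "g \<in> carrier G" "h \<in> carrier G" "disp g < 1/2 * ?\<delta>" "disp h < 1/2 * ?\<delta>" for g h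
    using displacement_quotient_le[OF that(1,2)] that(3,4) by simp
  then have "displacement_measure G \<mu> X m act (1/2 * ?\<delta>)
      \<le> inverse (real M + 1) * inverse (real N + 1)"
    using inv by (intro packing) blast+
  moreover have "displacement_measure G \<mu> X m act ?\<delta>
      \<le> inverse (real M + 1) * inverse (real N + 1)" if na: "nonarchimedean X m"
  proof (rule packing)
    fix g h assume "g \<in> carrier G" "h \<in> carrier G" "disp g < ?\<delta>" "disp h < ?\<delta>"
    then show "disp (g \<otimes>\<^bsub>G\<^esub> inv\<^bsub>G\<^esub> h) < ?\<delta>"
      using displacement_quotient_le_max[OF na, of g h] by simp
  qed (rule inv)
  ultimately show ?thesis by blast
qed

end
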